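(* Let $q$ be odd with $q\equiv-1\pmod3$, and let $\mu\in\mathbb{F}_q$ be a non-square. Let $L_c$ be the line through $\mathbf{P}(1,0,0,1)$ and $\mathbf{P}(0,0,1,0)$, and $\ell_\mu$ the line through $\mathbf{P}(0,\mu,0,1)$ and $\mathbf{P}(1,0,1,0)$. Then $L_c$ and $\ell_\mu$ belong to the same orbit of $G_q$ if and only if $\mu=-1/3$ and $q\equiv-1\pmod{12}$.
   Context: Points of $\mathrm{PG}(3,q)$ are written $\mathbf{P}(x_0,x_1,x_2,x_3)$ over $\mathbb{F}_q$. The twisted cubic is $\mathscr{C}=\{\mathbf{P}(t^3,t^2,t,1):t\in\mathbb{F}_q\}\cup\{\mathbf{P}(1,0,0,0)\}$ and $G_q$ is the group of projectivities of $\mathrm{PG}(3,q)$ fixing $\mathscr{C}$. Two lines are in the same orbit if an element of $G_q$ maps one onto the other. *)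

theory Defs
  imports "HOL-Analysis.Analysis"
begin

text \<open>Homogeneous coordinates (x0,x1,x2,x3) of PG(3,q) as vectors in 'a^4.\<close>
definition vec4 :: "'a::zero \<Rightarrow> 'a \<Rightarrow> 'a \<Rightarrow> 'a \<Rightarrow> 'a ^ 4" where
  "vec4 a b c d = vector [a, b, c, d]"

text \<open>The projective point P(v): the set of nonzero scalar multiples of v (v nonzero).\<close>
definition proj_pt :: "'a::field ^ 4 \<Rightarrow> ('a ^ 4) set" where
  "proj_pt v = {c *s v | c. c \<noteq> 0}"

definition PPt :: "'a::field \<Rightarrow> 'a \<Rightarrow> 'a \<Rightarrow> 'a \<Rightarrow> ('a ^ 4) set" where
  "PPt a b c d = proj_pt (vec4 a b c d)"

text \<open>The line through two (distinct) points P(u), P(v), as a set of points.\<close>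
definition proj_line :: "'a::field ^ 4 \<Rightarrow> 'a ^ 4 \<Rightarrow> ('a ^ 4) set set" where
  "proj_line u v = {proj_pt (a *s u + b *s v) | a b. a \<noteq> 0 \<or> b \<noteq> 0}"

text \<open>The projectivity induced by a matrix A, acting on a set of points.\<close>
definition proj_act :: "'a::field ^ 4 ^ 4 \<Rightarrow> ('a ^ 4) set set \<Rightarrow> ('a ^ 4) set set" where
  "proj_act A S = (\<lambda>P. (\<lambda>x. A *v x) ` P) ` S"

text \<open>The twisted cubic.\<close>
definition twisted_cubic :: "('a::field ^ 4) set set" where
  "twisted_cubic = {PPt (t^3) (t^2) t 1 | t. True} \<union> {PPt 1 0 0 0}"

text \<open>G_q: projectivities (invertible matrices) preserving the twisted cubic.\<close>
definition Gq :: "('a::field ^ 4 ^ 4) set" where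
  "Gq = {A. invertible A \<and> proj_act A twisted_cubic = twisted_cubic}"

definition same_orbit :: "('a::field ^ 4) set set \<Rightarrow> ('a ^ 4) set set \<Rightarrow> bool" where
  "same_orbit L M \<longleftrightarrow> (\<exists>A \<in> Gq. proj_act A L = M)"

end

(* Every projectivity fixing the twisted cubic is, up to a scalar, induced by a substitution
   (x, y) |-> (a x + b y, c x + d y) acting on (x^3, x^2 y, x y^2, y^3), provided 2 and 3 are
   invertible: after moving the images of P(1,0,0,0) and P(0,0,0,1) back, the conditions that
   points of the cubic stay on the quadrics x0 x2 = x1^2 and x1 x3 = x2^2 are polynomial identities
   in the parameter, and they force the matrix to be diagonal.
   So L_c and l_mu lie in one orbit iff some such substitution with ad <> bc sends P(1,0,0,1) and
   P(0,0,1,0) into l_mu, which is four polynomial equations in a, b, c, d. Eliminating, they force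
   (ad)^2 + 4 (ad)(bc) + (bc)^2 = 0 and (3 mu + 1) ad bc = 0, hence mu = -1/3 and 3 is a square.
   Conversely, for mu = -1/3 a solution is built from a square root of 3, a square root of 1 + 2r
   for one of the roots r = -2 +- sqrt 3 (one of them works because -3 = 9 mu is a non-square), and
   a cube root, which exists since q = 2 mod 3. Finally, when -3 is a non-square, 3 is a square iff
   -1 is not, i.e. iff q = 3 mod 4. *)

theory Submission
  imports Defs "HOL-Computational_Algebra.Polynomial" "HOL-Computational_Algebra.Primes"
begin

section \<open>Finite fields\<close>

lemma of_nat_CARD_eq_0: "of_nat CARD('a) = (0::'a::{finite,field})"
proof -
  have "(\<Sum>x\<in>UNIV. x) = (\<Sum>x\<in>UNIV. x + (1::'a))"
    by (rule sum.reindex_bij_witness[of _ "\<lambda>x. x + 1" "\<lambda>x. x - 1"]) auto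
  then show ?thesis by (simp add: sum.distrib)
qed

lemma of_nat_prime_neq_0:
  assumes "prime p" "\<not> p dvd CARD('a::{finite,field})"
  shows "of_nat p \<noteq> (0::'a)"
proof
  assume "of_nat p = (0::'a)"
  then have "CHAR('a) dvd p" by (simp add: of_nat_eq_0_iff_char_dvd)
  moreover have "prime CHAR('a)"
    by (simp add: finite_imp_CHAR_pos prime_CHAR_semidom)
  ultimately have "CHAR('a) = p" using assms(1) by (simp add: primes_dvd_imp_eq)
  then show False
    using assms(2) of_nat_CARD_eq_0[where 'a='a] by (simp add: of_nat_eq_0_iff_char_dvd)
qed

lemma two_neq_0_finite_field: "odd CARD('a::{finite,field}) \<Longrightarrow> (2::'a) \<noteq> 0"
  using of_nat_prime_neq_0[of 2, where 'a='a] by simp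

lemma three_neq_0_finite_field: "CARD('a::{finite,field}) mod 3 = 2 \<Longrightarrow> (3::'a) \<noteq> 0"
  using of_nat_prime_neq_0[of 3, where 'a='a] by (auto simp: dvd_eq_mod_eq_0)

lemma power_CARD_minus_1:
  assumes "(x::'a::{finite,field}) \<noteq> 0"
  shows "x ^ (CARD('a) - 1) = 1"
proof -
  have "(\<Prod>y\<in>UNIV-{0}. y) = (\<Prod>y\<in>UNIV-{0::'a}. x * y)"
    by (rule prod.reindex_bij_witness[of _ "\<lambda>y. x * y" "\<lambda>y. y / x"]) (use assms in auto)
  also have "\<dots> = x ^ (CARD('a) - 1) * (\<Prod>y\<in>UNIV-{0}. y)"
    by (simp add: prod.distrib card_Diff_singleton)
  finally show ?thesis
    by (simp add: prod_zero_iff)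
qed

lemma power_CARD_eq_same: "(x::'a::{finite,field}) ^ CARD('a) = x"
  using power_CARD_minus_1[of x] power_minus_mult[of "CARD('a)" x] by (cases "x = 0") auto

lemma exists_cube_root:
  assumes "CARD('a::{finite,field}) mod 3 = 2"
  shows "\<exists>y. y ^ 3 = (x::'a)"
proof (cases "x = 0")
  case False
  have "(2 * CARD('a) - 1) div 3 * 3 = CARD('a) + (CARD('a) - 1)"
    using assms by presburger
  then have "(x ^ ((2 * CARD('a) - 1) div 3)) ^ 3 = x ^ CARD('a) * x ^ (CARD('a) - 1)"
    by (simp only: power_mult[symmetric] power_add)
  also have "\<dots> = x"
    using power_CARD_minus_1[OF False] by (simp add: power_CARD_eq_same)
  finally show ?thesis ..
qed auto

lemma card_roots_unity_le:
  assumes "n > 0"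
  shows "card {x::'a::idom. x ^ n = 1} \<le> n"
proof -
  let ?p = "monom (1::'a) n - 1"
  have "coeff ?p n = 1" using assms by simp
  then have "?p \<noteq> 0" by (metis coeff_0 zero_neq_one)
  moreover have "degree ?p \<le> n"
    by (simp add: degree_diff_le degree_monom_le)
  moreover have "{x. poly ?p x = 0} = {x. x ^ n = 1}"
    by (simp add: poly_monom)
  ultimately show ?thesis
    using card_poly_roots_bound[of ?p] by simp
qed

lemma card_nonzero_squares:
  assumes "odd CARD('a::{finite,field})"
  shows "card ((\<lambda>x::'a. x ^ 2) ` (UNIV - {0})) = CARD('a) div 2"
proof -
  let ?U = "UNIV - {0::'a}"
  have fibre: "card {x \<in> ?U. x ^ 2 = y} = 2" if "y \<in> (\<lambda>x. x ^ 2) ` ?U" for y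
  proof -
    from that obtain z where z: "z \<noteq> 0" "y = z ^ 2" by auto
    then have "{x \<in> ?U. x ^ 2 = y} = {z, -z}" by (auto simp: power2_eq_iff)
    moreover have "z \<noteq> -z"
      using z two_neq_0_finite_field[OF assms] by (simp add: eq_neg_iff_add_eq_0 flip: mult_2)
    ultimately show ?thesis by simp
  qed
  have "CARD('a) - 1 = card ?U"
    by (simp add: card_Diff_singleton)
  also have "\<dots> = (\<Sum>y\<in>(\<lambda>x. x ^ 2) ` ?U. card {x \<in> ?U. x ^ 2 = y})"
    unfolding card_eq_sum by (rule sum.image_gen) simp
  also have "\<dots> = 2 * card ((\<lambda>x. x ^ 2) ` ?U)"
    using fibre by simp
  finally show ?thesis
    using odd_two_times_div_two_nat[OF assms] by simp
qed

lemma nonzero_squares_eq_roots: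
  assumes "odd CARD('a::{finite,field})"
  shows "(\<lambda>x. x ^ 2) ` (UNIV - {0}) = {x::'a. x ^ (CARD('a) div 2) = 1}"
proof (rule card_seteq)
  show "(\<lambda>x. x ^ 2) ` (UNIV - {0}) \<subseteq> {x::'a. x ^ (CARD('a) div 2) = 1}"
  proof clarify
    fix y :: 'a assume "y \<noteq> 0"
    then show "(y ^ 2) ^ (CARD('a) div 2) = 1"
      using power_CARD_minus_1 odd_two_times_div_two_nat[OF assms] by (simp add: power_mult[symmetric])
  qed
  have "card {0, 1::'a} \<le> CARD('a)" by (rule card_mono) auto
  then have "CARD('a) div 2 > 0" using assms by simp
  then show "card {x::'a. x ^ (CARD('a) div 2) = 1} \<le> card ((\<lambda>x. x ^ 2) ` (UNIV - {0::'a}))"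
    using card_roots_unity_le[of "CARD('a) div 2", where 'a='a] card_nonzero_squares[OF assms] by simp
qed simp

lemma square_iff_power_half_card:
  assumes "odd CARD('a::{finite,field})" "(x::'a) \<noteq> 0"
  shows "(\<exists>y. y ^ 2 = x) \<longleftrightarrow> x ^ (CARD('a) div 2) = 1"
proof -
  have "(\<exists>y. y ^ 2 = x) \<longleftrightarrow> x \<in> (\<lambda>x. x ^ 2) ` (UNIV - {0})"
    using assms(2) by force
  then show ?thesis
    by (simp add: nonzero_squares_eq_roots[OF assms(1)])
qed

lemma nonsquare_power_half_card:
  assumes "odd CARD('a::{finite,field})" "\<nexists>y. y ^ 2 = (x::'a)"
  shows "x ^ (CARD('a) div 2) = -1"
proof -
  have "x \<noteq> 0" using assms(2) by (metis power_zero_numeral)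
  then have "(x ^ (CARD('a) div 2)) ^ 2 = 1"
    using power_CARD_minus_1 odd_two_times_div_two_nat[OF assms(1)]
    by (simp add: power_mult[symmetric] mult.commute)
  moreover have "x ^ (CARD('a) div 2) \<noteq> 1"
    using square_iff_power_half_card[OF assms(1) \<open>x \<noteq> 0\<close>] assms(2) by blast
  ultimately show ?thesis
    by (simp add: power2_eq_1_iff)
qed

lemma nonsquare_mult_nonsquare:
  assumes "odd CARD('a::{finite,field})" "\<nexists>y. y ^ 2 = (x::'a)" "\<nexists>y. y ^ 2 = z"
  shows "\<exists>y. y ^ 2 = x * z"
proof -
  have "x * z \<noteq> 0" using assms(2,3) by (metis mult_eq_0_iff power_zero_numeral)
  moreover have "(x * z) ^ (CARD('a) div 2) = 1"
    using nonsquare_power_half_card[OF assms(1)] assms(2,3) by (simp add: power_mult_distrib)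
  ultimately show ?thesis
    using square_iff_power_half_card[OF assms(1)] by blast
qed

lemma minus_one_square_iff:
  assumes "odd CARD('a::{finite,field})"
  shows "(\<exists>y::'a. y ^ 2 = -1) \<longleftrightarrow> CARD('a) mod 4 = 1"
proof -
  have "(-1::'a) \<noteq> 1"
    using two_neq_0_finite_field[OF assms] by (metis add_eq_0_iff one_add_one)
  then have "(-1::'a) ^ (CARD('a) div 2) = 1 \<longleftrightarrow> even (CARD('a) div 2)"
    by (cases "even (CARD('a) div 2)") simp_all
  also have "\<dots> \<longleftrightarrow> CARD('a) mod 4 = 1"
    using assms by presburger
  finally show ?thesis
    using square_iff_power_half_card[OF assms, of "-1"] by simp
qed

section \<open>Points and lines\<close>

lemma vec4_nth [simp]:
  "vec4 a b c d $ 1 = a" "vec4 a b c d $ 2 = b" "vec4 a b c d $ 3 = c" "vec4 a b c d $ 4 = d"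
  unfolding vec4_def vector_def by simp_all

lemma vec4_eq_iff: "(z::'a::zero^4) = vec4 a b c d \<longleftrightarrow> z$1 = a \<and> z$2 = b \<and> z$3 = c \<and> z$4 = d"
  by (auto simp: vec_eq_iff forall_4)

lemma matrix_vector_mult_4:
  "((A::'a::semiring_1^4^'m) *v z) $ i = A$i$1 * z$1 + A$i$2 * z$2 + A$i$3 * z$3 + A$i$4 * z$4"
  by (simp add: matrix_vector_mult_def sum_4)

lemma matrix_matrix_mult_4:
  "((A::'a::semiring_1^4^'m) ** (B::'a^'n^4)) $ i $ j
     = A$i$1 * B$1$j + A$i$2 * B$2$j + A$i$3 * B$3$j + A$i$4 * B$4$j"
  by (simp add: matrix_matrix_mult_def sum_4)

lemma proj_pt_self: "v \<in> proj_pt v"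
  unfolding proj_pt_def by (auto intro: exI[of _ 1])

lemma proj_pt_smult:
  assumes "c \<noteq> 0"
  shows "proj_pt (c *s v) = proj_pt (v::'a::field^4)"
proof -
  have "(\<exists>d. x = d *s (c *s v) \<and> d \<noteq> 0) \<longleftrightarrow> (\<exists>d. x = d *s v \<and> d \<noteq> 0)" for x
    using assms by (metis mult_eq_0_iff vector_smult_assoc nonzero_divide_eq_eq divide_eq_0_iff)
  then show ?thesis
    unfolding proj_pt_def by blast
qed

lemma proj_pt_eqD:
  "proj_pt u = proj_pt (v::'a::field^4) \<Longrightarrow> \<exists>c. c \<noteq> 0 \<and> u = c *s v"
  using proj_pt_self[of u] unfolding proj_pt_def by auto

lemma image_proj_pt: "(*v) A ` proj_pt v = proj_pt ((A::'a::field^4^4) *v v)"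
proof -
  have "(*v) A ` {c *s v |c. c \<noteq> 0} = {A *v (c *s v) |c. c \<noteq> 0}"
    by blast
  then show ?thesis
    unfolding proj_pt_def by (simp add: vector_scalar_commute)
qed

lemma proj_act_proj_line:
  "proj_act (A::'a::field^4^4) (proj_line u v) = proj_line (A *v u) (A *v v)"
proof -
  have "proj_act A (proj_line u v)
      = {(*v) A ` proj_pt (a *s u + b *s v) |a b. a \<noteq> 0 \<or> b \<noteq> 0}"
    unfolding proj_act_def proj_line_def by blast
  then show ?thesis
    unfolding proj_line_def
    by (simp add: image_proj_pt vector_scalar_commute matrix_vector_right_distrib)
qed

lemma proj_pt_in_proj_line_left: "proj_pt u \<in> proj_line u (v::'a::field^4)"
  unfolding proj_line_def by (intro CollectI exI[of _ 1] exI[of _ 0]) simp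

lemma proj_pt_in_proj_line_right: "proj_pt v \<in> proj_line u (v::'a::field^4)"
  unfolding proj_line_def by (intro CollectI exI[of _ 0] exI[of _ 1]) simp

lemma proj_pt_in_proj_lineD:
  assumes "proj_pt z \<in> proj_line u (v::'a::field^4)"
  shows "\<exists>\<alpha> \<beta>. z = \<alpha> *s u + \<beta> *s v"
proof -
  obtain a b where "proj_pt z = proj_pt (a *s u + b *s v)"
    using assms unfolding proj_line_def by blast
  then obtain c where "z = c *s (a *s u + b *s v)"
    using proj_pt_eqD by blast
  then have "z = (c * a) *s u + (c * b) *s v"
    by (simp add: vector_add_ldistrib vector_smult_assoc)
  then show ?thesis by blast
qed

lemma ex_nonzero_pair_linear_iff:
  fixes \<alpha> \<beta> \<gamma> \<delta> :: "'a::field"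
  assumes "\<alpha> * \<delta> - \<beta> * \<gamma> \<noteq> 0"
  shows "(\<exists>x y. (x \<noteq> 0 \<or> y \<noteq> 0) \<and> P (\<alpha> * x + \<beta> * y) (\<gamma> * x + \<delta> * y))
     \<longleftrightarrow> (\<exists>x y. (x \<noteq> 0 \<or> y \<noteq> 0) \<and> P x y)"
proof
  let ?D = "\<alpha> * \<delta> - \<beta> * \<gamma>"
  assume "\<exists>x y. (x \<noteq> 0 \<or> y \<noteq> 0) \<and> P (\<alpha> * x + \<beta> * y) (\<gamma> * x + \<delta> * y)"
  then obtain x y where nz: "x \<noteq> 0 \<or> y \<noteq> 0" and P: "P (\<alpha> * x + \<beta> * y) (\<gamma> * x + \<delta> * y)"
    by blast
  have "?D * x = \<delta> * (\<alpha> * x + \<beta> * y) - \<beta> * (\<gamma> * x + \<delta> * y)"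
    and "?D * y = \<alpha> * (\<gamma> * x + \<delta> * y) - \<gamma> * (\<alpha> * x + \<beta> * y)"
    by (simp_all add: algebra_simps)
  then have "\<alpha> * x + \<beta> * y \<noteq> 0 \<or> \<gamma> * x + \<delta> * y \<noteq> 0"
    using nz assms by auto
  with P show "\<exists>x y. (x \<noteq> 0 \<or> y \<noteq> 0) \<and> P x y" by blast
next
  let ?D = "\<alpha> * \<delta> - \<beta> * \<gamma>"
  assume "\<exists>x y. (x \<noteq> 0 \<or> y \<noteq> 0) \<and> P x y"
  then obtain x y where nz: "x \<noteq> 0 \<or> y \<noteq> 0" and P: "P x y"
    by blast
  define x' where "x' = (\<delta> * x - \<beta> * y) / ?D"
  define y' where "y' = (\<alpha> * y - \<gamma> * x) / ?D"
  have "\<alpha> * x' + \<beta> * y' = (\<alpha> * (\<delta> * x - \<beta> * y) + \<beta> * (\<alpha> * y - \<gamma> * x)) / ?D"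
    and "\<gamma> * x' + \<delta> * y' = (\<gamma> * (\<delta> * x - \<beta> * y) + \<delta> * (\<alpha> * y - \<gamma> * x)) / ?D"
    unfolding x'_def y'_def by (simp_all add: add_divide_distrib)
  moreover have "\<alpha> * (\<delta> * x - \<beta> * y) + \<beta> * (\<alpha> * y - \<gamma> * x) = ?D * x"
    and "\<gamma> * (\<delta> * x - \<beta> * y) + \<delta> * (\<alpha> * y - \<gamma> * x) = ?D * y"
    by (simp_all add: algebra_simps)
  ultimately have "\<alpha> * x' + \<beta> * y' = x" "\<gamma> * x' + \<delta> * y' = y"
    using assms by simp_all
  moreover from this have "x' \<noteq> 0 \<or> y' \<noteq> 0"
    using nz by auto
  ultimately show "\<exists>x y. (x \<noteq> 0 \<or> y \<noteq> 0) \<and> P (\<alpha> * x + \<beta> * y) (\<gamma> * x + \<delta> * y)"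
    using P by metis
qed

lemma proj_line_lincomb:
  fixes u v :: "'a::field^4"
  assumes "\<alpha> * \<delta> - \<beta> * \<gamma> \<noteq> 0"
  shows "proj_line (\<alpha> *s u + \<beta> *s v) (\<gamma> *s u + \<delta> *s v) = proj_line u v"
proof (rule set_eqI)
  fix P
  have comb: "a *s (\<alpha> *s u + \<beta> *s v) + b *s (\<gamma> *s u + \<delta> *s v)
      = (\<alpha> * a + \<gamma> * b) *s u + (\<beta> * a + \<delta> * b) *s v" for a b
    by (simp add: vec_eq_iff algebra_simps)
  have "P \<in> proj_line (\<alpha> *s u + \<beta> *s v) (\<gamma> *s u + \<delta> *s v) \<longleftrightarrow>
      (\<exists>a b. (a \<noteq> 0 \<or> b \<noteq> 0) \<and> P = proj_pt ((\<alpha> * a + \<gamma> * b) *s u + (\<beta> * a + \<delta> * b) *s v))"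
    unfolding proj_line_def comb by blast
  also have "\<dots> \<longleftrightarrow> (\<exists>a b. (a \<noteq> 0 \<or> b \<noteq> 0) \<and> P = proj_pt (a *s u + b *s v))"
    using assms by (intro ex_nonzero_pair_linear_iff) (simp add: mult.commute)
  also have "\<dots> \<longleftrightarrow> P \<in> proj_line u v"
    unfolding proj_line_def by blast
  finally show "P \<in> proj_line (\<alpha> *s u + \<beta> *s v) (\<gamma> *s u + \<delta> *s v) \<longleftrightarrow> P \<in> proj_line u v" .
qed

lemma proj_line_smult:
  "\<kappa> \<noteq> 0 \<Longrightarrow> proj_line (\<kappa> *s u) (\<kappa> *s v) = proj_line u (v::'a::field^4)"
  using proj_line_lincomb[of \<kappa> \<kappa> 0 0 u v] by simp

lemma proj_act_mult: "proj_act (A ** B) S = proj_act A (proj_act (B::'a::field^4^4) S)"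
  unfolding proj_act_def by (simp add: image_image matrix_vector_mul_assoc)

lemma invertible_matrix_vector_eq_0:
  "invertible (A::'a::field^'n^'n) \<Longrightarrow> A *v z = 0 \<longleftrightarrow> z = 0"
  by (metis inj_matrix_vector_mult injD matrix_vector_mult_0_right)

lemma invertible_row_neq_0:
  assumes "invertible (A::'a::field^'n^'n)"
  shows "A $ i \<noteq> 0"
proof
  assume "A $ i = 0"
  obtain A' where "A ** A' = mat 1"
    using assms unfolding invertible_def by blast
  then have "(A ** A') $ i $ i = 1"
    by (simp add: mat_def)
  then show False
    using \<open>A $ i = 0\<close> by (simp add: matrix_matrix_mult_def)
qed

lemma proj_act_proj_line_eq:
  fixes M :: "'a::field^4^4"
  assumes "invertible M"
    and indep: "\<And>x y. x *s u + y *s v = 0 \<Longrightarrow> x = 0 \<and> y = 0"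
    and Mu: "M *v u = \<alpha> *s u' + \<beta> *s v'" and Mv: "M *v v = \<gamma> *s u' + \<delta> *s v'"
  shows "proj_act M (proj_line u v) = proj_line u' v'"
proof -
  have "\<alpha> * \<delta> - \<beta> * \<gamma> \<noteq> 0"
  proof
    assume det: "\<alpha> * \<delta> - \<beta> * \<gamma> = 0"
    have "M *v (\<delta> *s u - \<beta> *s v) = 0" "M *v (\<gamma> *s u - \<alpha> *s v) = 0"
      using det by (simp_all add: matrix_vector_mult_diff_distrib vector_scalar_commute Mu Mv vec_eq_iff algebra_simps)
    then have "\<delta> = 0 \<and> \<beta> = 0" "\<gamma> = 0 \<and> \<alpha> = 0"
      using indep[of \<delta> "- \<beta>"] indep[of \<gamma> "- \<alpha>"] \<open>invertible M\<close>
      by (simp_all add: invertible_matrix_vector_eq_0)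
    then have "M *v u = 0"
      using Mu by simp
    then show False
      using indep[of 1 0] \<open>invertible M\<close> by (simp add: invertible_matrix_vector_eq_0)
  qed
  then show ?thesis
    unfolding proj_act_proj_line Mu Mv by (rule proj_line_lincomb)
qed

section \<open>The twisted cubic and the group \<open>G\<^sub>q\<close>\<close>

definition cubic_vec :: "'a::comm_ring_1 \<Rightarrow> 'a \<Rightarrow> 'a^4" where
  "cubic_vec x y = vec4 (x^3) (x^2 * y) (x * y^2) (y^3)"

definition cubic_mat :: "'a::comm_ring_1 \<Rightarrow> 'a \<Rightarrow> 'a \<Rightarrow> 'a \<Rightarrow> 'a^4^4" where
  "cubic_mat a b c d =
     vec4 (vec4 (a^3) (3*a^2*b) (3*a*b^2) (b^3))
          (vec4 (a^2*c) (a^2*d + 2*a*b*c) (2*a*b*d + b^2*c) (b^2*d))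
          (vec4 (a*c^2) (2*a*c*d + b*c^2) (a*d^2 + 2*b*c*d) (b*d^2))
          (vec4 (c^3) (3*c^2*d) (3*c*d^2) (d^3))"

lemma cubic_mat_cubic_vec:
  "cubic_mat a b c d *v cubic_vec x y = cubic_vec (a*x + b*y) (c*x + d*y)"
  unfolding vec_eq_iff forall_4 matrix_vector_mult_4
  by (simp add: cubic_mat_def cubic_vec_def) (simp add: power2_eq_square power3_eq_cube algebra_simps)

lemma cubic_mat_mult:
  "cubic_mat a b c d ** cubic_mat a' b' c' d'
     = cubic_mat (a*a' + b*c') (a*b' + b*d') (c*a' + d*c') (c*b' + d*d')"
  unfolding vec_eq_iff forall_4 matrix_matrix_mult_4
  by (simp add: cubic_mat_def) (simp add: power2_eq_square power3_eq_cube algebra_simps)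

lemma cubic_mat_id: "cubic_mat 1 0 0 1 = mat 1"
  unfolding vec_eq_iff forall_4 by (simp add: cubic_mat_def mat_def)

lemma cubic_mat_scalar: "cubic_mat a 0 0 a *v z = a^3 *s z"
  unfolding vec_eq_iff forall_4 matrix_vector_mult_4
  by (simp add: cubic_mat_def power2_eq_square power3_eq_cube algebra_simps)

lemma cubic_vec_smult: "cubic_vec (c*x) (c*y) = c^3 *s cubic_vec x y"
  unfolding vec_eq_iff forall_4
  by (simp add: cubic_vec_def power_mult_distrib power2_eq_square power3_eq_cube algebra_simps)

lemma mem_twisted_cubic_iff:
  "P \<in> twisted_cubic \<longleftrightarrow> (\<exists>x y. (x \<noteq> 0 \<or> y \<noteq> (0::'a::field)) \<and> P = proj_pt (cubic_vec x y))"
proof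
  assume "P \<in> twisted_cubic"
  then consider t where "P = proj_pt (cubic_vec t 1)" | "P = proj_pt (cubic_vec 1 (0::'a))"
    unfolding twisted_cubic_def PPt_def cubic_vec_def by auto
  then show "\<exists>x y. (x \<noteq> 0 \<or> y \<noteq> 0) \<and> P = proj_pt (cubic_vec x y)"
  proof cases
    case (1 t)
    then show ?thesis by (intro exI[of _ t] exI[of _ 1]) simp
  next
    case 2
    then show ?thesis by (intro exI[of _ 1] exI[of _ 0]) simp
  qed
next
  assume "\<exists>x y. (x \<noteq> 0 \<or> y \<noteq> 0) \<and> P = proj_pt (cubic_vec x y)"
  then obtain x y where nz: "x \<noteq> 0 \<or> y \<noteq> 0" and P: "P = proj_pt (cubic_vec x y)"
    by blast
  show "P \<in> twisted_cubic"
  proof (cases "y = 0")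
    case True
    then have "P = proj_pt (cubic_vec 1 0)"
      using P nz cubic_vec_smult[of x 1 0] by (simp add: proj_pt_smult)
    then show ?thesis
      unfolding twisted_cubic_def PPt_def cubic_vec_def by simp
  next
    case False
    then have "P = proj_pt (cubic_vec (x / y) 1)"
      using P cubic_vec_smult[of y "x / y" 1] by (simp add: proj_pt_smult)
    then show ?thesis
      unfolding twisted_cubic_def PPt_def cubic_vec_def by auto
  qed
qed

lemma invertible_cubic_mat:
  assumes "a * d - b * c \<noteq> (0::'a::field)"
  shows "invertible (cubic_mat a b c d)"
proof -
  define D where "D = a * d - b * c"
  have "a * (d / D) + b * (- c / D) = 1" "a * (- b / D) + b * (a / D) = 0"
    "c * (d / D) + d * (- c / D) = 0" "c * (- b / D) + d * (a / D) = 1"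
    using assms by (simp_all add: field_simps D_def[symmetric])
  then have "cubic_mat a b c d ** cubic_mat (d / D) (- b / D) (- c / D) (a / D) = cubic_mat 1 0 0 1"
    by (simp only: cubic_mat_mult)
  then show ?thesis
    unfolding invertible_right_inverse cubic_mat_id by auto
qed

lemma cubic_mat_in_Gq:
  assumes "a * d - b * c \<noteq> (0::'a::field)"
  shows "cubic_mat a b c d \<in> Gq"
proof -
  have "Q \<in> proj_act (cubic_mat a b c d) twisted_cubic \<longleftrightarrow> Q \<in> twisted_cubic" for Q
  proof -
    have "Q \<in> proj_act (cubic_mat a b c d) twisted_cubic \<longleftrightarrow>
        (\<exists>P. P \<in> twisted_cubic \<and> Q = (*v) (cubic_mat a b c d) ` P)"
      unfolding proj_act_def by blast
    also have "\<dots> \<longleftrightarrow>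
        (\<exists>x y. (x \<noteq> 0 \<or> y \<noteq> 0) \<and> Q = (*v) (cubic_mat a b c d) ` proj_pt (cubic_vec x y))"
      unfolding mem_twisted_cubic_iff by auto
    also have "\<dots> \<longleftrightarrow>
        (\<exists>x y. (x \<noteq> 0 \<or> y \<noteq> 0) \<and> Q = proj_pt (cubic_vec (a*x + b*y) (c*x + d*y)))"
      by (simp add: image_proj_pt cubic_mat_cubic_vec)
    also have "\<dots> \<longleftrightarrow> Q \<in> twisted_cubic"
      unfolding mem_twisted_cubic_iff using assms by (rule ex_nonzero_pair_linear_iff)
    finally show ?thesis .
  qed
  then show ?thesis
    unfolding Gq_def using invertible_cubic_mat[OF assms] by blast
qed

lemma Gq_mult: "A \<in> Gq \<Longrightarrow> B \<in> Gq \<Longrightarrow> A ** B \<in> (Gq :: ('a::field^4^4) set)"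
  unfolding Gq_def by (simp add: invertible_mult proj_act_mult)

lemma Gq_image_cubic_vec:
  assumes "A \<in> Gq" "x \<noteq> 0 \<or> y \<noteq> 0"
  shows "\<exists>c x' y'. c \<noteq> 0 \<and> (x' \<noteq> 0 \<or> y' \<noteq> 0) \<and> A *v cubic_vec x y = c *s cubic_vec x' y'"
proof -
  have "proj_pt (cubic_vec x y) \<in> twisted_cubic"
    using assms(2) mem_twisted_cubic_iff by blast
  then have "proj_pt (A *v cubic_vec x y) \<in> proj_act A twisted_cubic"
    unfolding proj_act_def by (auto simp: image_proj_pt[symmetric])
  then have "proj_pt (A *v cubic_vec x y) \<in> twisted_cubic"
    using assms(1) unfolding Gq_def by simp
  then show ?thesis
    unfolding mem_twisted_cubic_iff by (metis proj_pt_eqD)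
qed

lemma cubic_coeffs_eq_0:
  fixes c0 c1 c2 c3 :: "'a::field"
  assumes "(2::'a) \<noteq> 0" "(3::'a) \<noteq> 0"
    and vanish: "\<And>t. t \<noteq> 0 \<Longrightarrow> c0 + c1 * t + c2 * t^2 + c3 * t^3 = 0"
  shows "c0 = 0 \<and> c1 = 0 \<and> c2 = 0 \<and> c3 = 0"
proof -
  have "(6::'a) = 2 * 3" "(12::'a) = 2 * 2 * 3"
    by simp_all
  then have "(6::'a) \<noteq> 0" "(12::'a) \<noteq> 0"
    using assms(1,2) by (metis mult_eq_0_iff)+
  have at_1: "c0 + c1 + c2 + c3 = 0" and at_minus_1: "c0 - c1 + c2 - c3 = 0"
    using vanish[of 1] vanish[of "-1"] by simp_all
  have at_2: "c0 + 2*c1 + 4*c2 + 8*c3 = 0" and at_minus_2: "c0 - 2*c1 + 4*c2 - 8*c3 = 0"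
    using vanish[of 2] vanish[of "-2"] assms(1) by (simp_all add: mult.commute)
  have "6 * c2 = (c0 + 2*c1 + 4*c2 + 8*c3) + (c0 - 2*c1 + 4*c2 - 8*c3) - (c0 + c1 + c2 + c3) - (c0 - c1 + c2 - c3)"
    and "12 * c3 = (c0 + 2*c1 + 4*c2 + 8*c3) - (c0 - 2*c1 + 4*c2 - 8*c3) - 2 * ((c0 + c1 + c2 + c3) - (c0 - c1 + c2 - c3))"
    by (simp_all add: algebra_simps)
  then have "6 * c2 = 0" "12 * c3 = 0"
    by (simp_all only: at_1 at_minus_1 at_2 at_minus_2) simp_all
  then have "c2 = 0" "c3 = 0"
    using \<open>(6::'a) \<noteq> 0\<close> \<open>(12::'a) \<noteq> 0\<close> by simp_all
  then show ?thesis
    using at_1 at_minus_1 assms(1) by (simp add: eq_neg_iff_add_eq_0)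
qed

lemma cubic_vec_on_quadrics:
  assumes "z = c *s cubic_vec x y"
  shows "z$2 * z$4 = (z$3)^2 \<and> z$1 * z$3 = (z$2)^2"
  using assms by (simp add: cubic_vec_def power2_eq_square power3_eq_cube algebra_simps)

lemma Gq_image_cubic_vec_on_quadrics:
  assumes "A \<in> Gq" "x \<noteq> 0 \<or> y \<noteq> 0"
  shows "(A *v cubic_vec x y)$2 * (A *v cubic_vec x y)$4 = ((A *v cubic_vec x y)$3)^2
    \<and> (A *v cubic_vec x y)$1 * (A *v cubic_vec x y)$3 = ((A *v cubic_vec x y)$2)^2"
proof -
  obtain c x' y' where "A *v cubic_vec x y = c *s cubic_vec x' y'"
    using Gq_image_cubic_vec[OF assms] by blast
  then show ?thesis
    by (rule cubic_vec_on_quadrics)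
qed

lemma quadrics_force_diagonal:
  fixes p q :: "'a::field^4"
  assumes "(2::'a) \<noteq> 0" "(3::'a) \<noteq> 0" "\<alpha> \<noteq> 0" "\<delta> \<noteq> 0" "p$2 \<noteq> 0 \<or> q$2 \<noteq> 0"
    and quadrics: "\<And>t. (p$2*t^2 + q$2*t) * (p$4*t^2 + q$4*t + \<delta>) = (p$3*t^2 + q$3*t)^2
      \<and> (\<alpha>*t^3 + p$1*t^2 + q$1*t) * (p$3*t^2 + q$3*t) = (p$2*t^2 + q$2*t)^2"
  shows "\<exists>k. k \<noteq> 0 \<and> \<alpha> = \<delta> * k^3 \<and> p = vec4 0 (\<delta> * k^2) 0 0 \<and> q = vec4 0 0 (\<delta> * k) 0"
proof -
  have "q$2*\<delta> + (p$2*\<delta> + q$2*q$4 - (q$3)^2)*t + (p$2*q$4 + q$2*p$4 - 2*p$3*q$3)*t^2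
        + (p$2*p$4 - (p$3)^2)*t^3 = 0" if "t \<noteq> 0" for t
  proof -
    have "t * (q$2*\<delta> + (p$2*\<delta> + q$2*q$4 - (q$3)^2)*t + (p$2*q$4 + q$2*p$4 - 2*p$3*q$3)*t^2
        + (p$2*p$4 - (p$3)^2)*t^3)
      = (p$2*t^2 + q$2*t) * (p$4*t^2 + q$4*t + \<delta>) - (p$3*t^2 + q$3*t)^2"
      by (simp add: power2_eq_square power3_eq_cube algebra_simps)
    then show ?thesis using quadrics[of t] that by simp
  qed
  then have Q1: "q$2*\<delta> = 0" "p$2*\<delta> + q$2*q$4 - (q$3)^2 = 0"
      "p$2*q$4 + q$2*p$4 - 2*p$3*q$3 = 0" "p$2*p$4 - (p$3)^2 = 0"
    using cubic_coeffs_eq_0[OF assms(1,2)] by blast+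
  have "(q$1*q$3 - (q$2)^2) + (p$1*q$3 + q$1*p$3 - 2*p$2*q$2)*t + (\<alpha>*q$3 + p$1*p$3 - (p$2)^2)*t^2
        + (\<alpha>*p$3)*t^3 = 0" if "t \<noteq> 0" for t
  proof -
    have "t^2 * ((q$1*q$3 - (q$2)^2) + (p$1*q$3 + q$1*p$3 - 2*p$2*q$2)*t
        + (\<alpha>*q$3 + p$1*p$3 - (p$2)^2)*t^2 + (\<alpha>*p$3)*t^3)
      = (\<alpha>*t^3 + p$1*t^2 + q$1*t) * (p$3*t^2 + q$3*t) - (p$2*t^2 + q$2*t)^2"
      by (simp add: power2_eq_square power3_eq_cube algebra_simps)
    then show ?thesis using quadrics[of t] that by simp
  qed
  then have Q2: "q$1*q$3 - (q$2)^2 = 0" "p$1*q$3 + q$1*p$3 - 2*p$2*q$2 = 0"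
      "\<alpha>*q$3 + p$1*p$3 - (p$2)^2 = 0" "\<alpha>*p$3 = 0"
    using cubic_coeffs_eq_0[OF assms(1,2)] by blast+
  have "q$2 = 0" "p$3 = 0"
    using Q1(1) Q2(4) assms(3,4) by simp_all
  then have p2: "p$2 * \<delta> = (q$3)^2" and "p$2 \<noteq> 0"
    using Q1(2) assms(5) by simp_all
  then have "q$3 \<noteq> 0"
    using assms(4) by auto
  have zeros: "p$4 = 0" "q$1 = 0" "p$1 = 0" "q$4 = 0"
    using Q1(3,4) Q2(1,2) \<open>p$2 \<noteq> 0\<close> \<open>q$3 \<noteq> 0\<close> \<open>q$2 = 0\<close> \<open>p$3 = 0\<close> by simp_all
  define k where "k = q$3 / \<delta>"
  have k: "k \<noteq> 0" "q$3 = \<delta> * k"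
    using \<open>q$3 \<noteq> 0\<close> assms(4) by (simp_all add: k_def)
  then have k2: "p$2 = \<delta> * k^2"
    using p2 assms(4) by (simp add: power2_eq_square)
  then have "\<alpha> = \<delta> * k^3"
    using Q2(3) k \<open>p$3 = 0\<close> assms(4) by (simp add: power2_eq_square power3_eq_cube)
  moreover have "p = vec4 0 (\<delta> * k^2) 0 0" "q = vec4 0 0 (\<delta> * k) 0"
    using zeros k k2 \<open>q$2 = 0\<close> \<open>p$3 = 0\<close> by (simp_all add: vec4_eq_iff)
  ultimately show ?thesis
    using \<open>k \<noteq> 0\<close> by blast
qed

lemma Gq_fixing_two_points:
  fixes B :: "'a::field^4^4"
  assumes "(2::'a) \<noteq> 0" "(3::'a) \<noteq> 0" and "B \<in> Gq"
    and e1: "B *v cubic_vec 1 0 = \<alpha> *s cubic_vec 1 0"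
    and e4: "B *v cubic_vec 0 1 = \<delta> *s cubic_vec 0 1"
  shows "\<exists>k. k \<noteq> 0 \<and> (\<forall>z. B *v z = \<delta> *s (cubic_mat k 0 0 1 *v z))"
proof -
  have "invertible B" using \<open>B \<in> Gq\<close> unfolding Gq_def by blast
  then have "\<alpha> \<noteq> 0" "\<delta> \<noteq> 0"
    using e1 e4 unfolding cubic_vec_def
    by (metis invertible_matrix_vector_eq_0 vector_smult_lzero vec4_nth(1,4) zero_index zero_neq_one power_one)+
  have col1: "B$1$1 = \<alpha>" "B$2$1 = 0" "B$3$1 = 0" "B$4$1 = 0"
    using e1 by (simp_all add: vec_eq_iff forall_4 matrix_vector_mult_4 cubic_vec_def)
  have col4: "B$1$4 = 0" "B$2$4 = 0" "B$3$4 = 0" "B$4$4 = \<delta>"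
    using e4 by (simp_all add: vec_eq_iff forall_4 matrix_vector_mult_4 cubic_vec_def)
  define p where "p = B *v vec4 0 1 0 0"
  define q where "q = B *v vec4 0 0 1 0"
  have p: "p$i = B$i$2" and q: "q$i = B$i$3" for i
    by (simp_all add: p_def q_def matrix_vector_mult_4)
  have image: "B *v cubic_vec t 1 = vec4 (\<alpha>*t^3 + p$1*t^2 + q$1*t) (p$2*t^2 + q$2*t)
                                        (p$3*t^2 + q$3*t) (p$4*t^2 + q$4*t + \<delta>)" for t
    unfolding vec4_eq_iff matrix_vector_mult_4 by (simp add: cubic_vec_def col1 col4 p q)
  have "p$2 \<noteq> 0 \<or> q$2 \<noteq> 0"
    using invertible_row_neq_0[OF \<open>invertible B\<close>, of 2] col1 col4
    by (auto simp: vec_eq_iff forall_4 p q)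
  moreover have "(p$2*t^2 + q$2*t) * (p$4*t^2 + q$4*t + \<delta>) = (p$3*t^2 + q$3*t)^2
      \<and> (\<alpha>*t^3 + p$1*t^2 + q$1*t) * (p$3*t^2 + q$3*t) = (p$2*t^2 + q$2*t)^2" for t
    using Gq_image_cubic_vec_on_quadrics[OF \<open>B \<in> Gq\<close>, of t 1] unfolding image by simp
  ultimately obtain k where k: "k \<noteq> 0" "\<alpha> = \<delta> * k^3"
    and "p = vec4 0 (\<delta> * k^2) 0 0" "q = vec4 0 0 (\<delta> * k) 0"
    using quadrics_force_diagonal[OF assms(1,2) \<open>\<alpha> \<noteq> 0\<close> \<open>\<delta> \<noteq> 0\<close>] by blast
  then have "B$i$2 = (vec4 0 (\<delta> * k^2) 0 0)$i" "B$i$3 = (vec4 0 0 (\<delta> * k) 0)$i" for i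
    using p q by metis+
  then have "B *v z = \<delta> *s (cubic_mat k 0 0 1 *v z)" for z
    using col1 col4 k unfolding vec_eq_iff forall_4
    by (simp add: cubic_mat_def matrix_vector_mult_4 algebra_simps)
  then show ?thesis
    using \<open>k \<noteq> 0\<close> by blast
qed

lemma cubic_vec_dependent:
  assumes "x1 * y2 = x2 * y1" "x2 \<noteq> 0 \<or> y2 \<noteq> (0::'a::field)"
  shows "\<exists>l. cubic_vec x1 y1 = l *s cubic_vec x2 y2"
proof (cases "y2 = 0")
  case True
  then have "x1 = (x1 / x2) * x2" "y1 = (x1 / x2) * y2"
    using assms by auto
  then show ?thesis
    by (metis cubic_vec_smult)
next
  case False
  then have "x1 = (y1 / y2) * x2" "y1 = (y1 / y2) * y2"
    using assms(1) by (simp_all add: field_simps)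
  then show ?thesis
    by (metis cubic_vec_smult)
qed

lemma Gq_end_images_distinct:
  assumes "A \<in> Gq"
    and A1: "A *v cubic_vec 1 0 = c1 *s cubic_vec x1 y1"
    and A2: "A *v cubic_vec 0 1 = c2 *s cubic_vec x2 y2"
    and "c2 \<noteq> 0" "x2 \<noteq> 0 \<or> y2 \<noteq> (0::'a::field)"
  shows "x1 * y2 - x2 * y1 \<noteq> 0"
proof
  assume "x1 * y2 - x2 * y1 = 0"
  then have "x1 * y2 = x2 * y1"
    by simp
  then obtain l where l: "cubic_vec x1 y1 = l *s cubic_vec x2 y2"
    using cubic_vec_dependent assms(5) by blast
  have "A *v (c2 *s cubic_vec 1 0 - (c1 * l) *s cubic_vec 0 1) = 0"
    using A1 A2 l by (simp add: matrix_vector_mult_diff_distrib vector_scalar_commute vector_smult_assoc mult_ac)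
  then have "c2 *s cubic_vec 1 0 - (c1 * l) *s cubic_vec 0 1 = 0"
    using \<open>A \<in> Gq\<close> invertible_matrix_vector_eq_0 unfolding Gq_def by blast
  then show False
    using \<open>c2 \<noteq> 0\<close> by (simp add: vec_eq_iff forall_4 cubic_vec_def)
qed

lemma Gq_eq_smult_cubic_mat:
  fixes A :: "'a::field^4^4"
  assumes "(2::'a) \<noteq> 0" "(3::'a) \<noteq> 0" and "A \<in> Gq"
  shows "\<exists>a b c d \<kappa>. a * d - b * c \<noteq> 0 \<and> \<kappa> \<noteq> 0 \<and> (\<forall>z. A *v z = \<kappa> *s (cubic_mat a b c d *v z))"
proof -
  obtain c1 x1 y1 where "c1 \<noteq> 0" and A1: "A *v cubic_vec 1 0 = c1 *s cubic_vec x1 y1"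
    using Gq_image_cubic_vec[OF \<open>A \<in> Gq\<close>, of 1 0] by auto
  obtain c2 x2 y2 where "c2 \<noteq> 0" "x2 \<noteq> 0 \<or> y2 \<noteq> 0" and A2: "A *v cubic_vec 0 1 = c2 *s cubic_vec x2 y2"
    using Gq_image_cubic_vec[OF \<open>A \<in> Gq\<close>, of 0 1] by auto
  define \<Delta> where "\<Delta> = x1 * y2 - x2 * y1"
  have "\<Delta> \<noteq> 0"
    unfolding \<Delta>_def
    by (rule Gq_end_images_distinct[OF \<open>A \<in> Gq\<close> A1 A2 \<open>c2 \<noteq> 0\<close> \<open>x2 \<noteq> 0 \<or> y2 \<noteq> 0\<close>])
  \<comment> \<open>\<open>N\<close> is the adjugate of the substitution sending the two ends to \<open>(x1, y1)\<close> and \<open>(x2, y2)\<close>.\<close>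
  define N where "N = cubic_mat y2 (- x2) (- y1) x1"
  define B where "B = N ** A"
  have "B \<in> Gq"
    unfolding B_def N_def using \<open>\<Delta> \<noteq> 0\<close> \<open>A \<in> Gq\<close>
    by (intro Gq_mult cubic_mat_in_Gq) (simp add: \<Delta>_def algebra_simps)
  have "B *v cubic_vec 1 0 = (c1 * \<Delta>^3) *s cubic_vec 1 0"
    using cubic_vec_smult[of \<Delta> 1 0]
    by (simp add: B_def N_def A1 \<Delta>_def cubic_mat_cubic_vec vector_scalar_commute vector_smult_assoc
        flip: matrix_vector_mul_assoc) (simp add: algebra_simps)
  moreover have "B *v cubic_vec 0 1 = (c2 * \<Delta>^3) *s cubic_vec 0 1"
    using cubic_vec_smult[of \<Delta> 0 1]
    by (simp add: B_def N_def A2 \<Delta>_def cubic_mat_cubic_vec vector_scalar_commute vector_smult_assoc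
        flip: matrix_vector_mul_assoc) (simp add: algebra_simps)
  ultimately obtain k where "k \<noteq> 0" and Bk: "\<And>z. B *v z = (c2 * \<Delta>^3) *s (cubic_mat k 0 0 1 *v z)"
    using Gq_fixing_two_points[OF assms(1,2) \<open>B \<in> Gq\<close>] by blast
  have "A *v z = c2 *s (cubic_mat (x1 * k) x2 (y1 * k) y2 *v z)" for z
  proof -
    have "cubic_mat x1 x2 y1 y2 ** N = cubic_mat \<Delta> 0 0 \<Delta>"
      unfolding N_def cubic_mat_mult \<Delta>_def by (simp add: algebra_simps)
    then have "\<Delta>^3 *s (A *v z) = cubic_mat x1 x2 y1 y2 *v (B *v z)"
      by (simp add: B_def matrix_vector_mul_assoc matrix_mul_assoc flip: cubic_mat_scalar)
    also have "\<dots> = \<Delta>^3 *s (c2 *s (cubic_mat (x1 * k) x2 (y1 * k) y2 *v z))"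
      by (simp add: Bk vector_scalar_commute matrix_vector_mul_assoc cubic_mat_mult vector_smult_assoc mult_ac)
    finally show ?thesis
      using \<open>\<Delta> \<noteq> 0\<close> by (simp add: vec_eq_iff)
  qed
  moreover have "(x1 * k) * y2 - x2 * (y1 * k) \<noteq> 0"
    using \<open>k \<noteq> 0\<close> \<open>\<Delta> \<noteq> 0\<close> unfolding \<Delta>_def by (simp add: algebra_simps)
  ultimately show ?thesis
    using \<open>c2 \<noteq> 0\<close> by blast
qed

lemma same_orbit_proj_line_iff:
  fixes u v u' v' :: "'a::field^4"
  assumes "(2::'a) \<noteq> 0" "(3::'a) \<noteq> 0"
    and indep: "\<And>x y. x *s u + y *s v = 0 \<Longrightarrow> x = 0 \<and> y = 0"
  shows "same_orbit (proj_line u v) (proj_line u' v') \<longleftrightarrow>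
    (\<exists>a b c d. a * d - b * c \<noteq> 0 \<and>
       (\<exists>\<alpha> \<beta>. cubic_mat a b c d *v u = \<alpha> *s u' + \<beta> *s v') \<and>
       (\<exists>\<gamma> \<delta>. cubic_mat a b c d *v v = \<gamma> *s u' + \<delta> *s v'))"
proof
  assume "same_orbit (proj_line u v) (proj_line u' v')"
  then obtain A where "A \<in> Gq" and A: "proj_line (A *v u) (A *v v) = proj_line u' v'"
    unfolding same_orbit_def proj_act_proj_line by blast
  obtain a b c d \<kappa> where det: "a * d - b * c \<noteq> 0" and "\<kappa> \<noteq> 0"
    and A_eq: "\<And>z. A *v z = \<kappa> *s (cubic_mat a b c d *v z)"
    using Gq_eq_smult_cubic_mat[OF assms(1,2) \<open>A \<in> Gq\<close>] by blast
  have "proj_line (cubic_mat a b c d *v u) (cubic_mat a b c d *v v) = proj_line u' v'"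
    using A \<open>\<kappa> \<noteq> 0\<close> by (simp add: A_eq proj_line_smult)
  then show "\<exists>a b c d. a * d - b * c \<noteq> 0 \<and>
       (\<exists>\<alpha> \<beta>. cubic_mat a b c d *v u = \<alpha> *s u' + \<beta> *s v') \<and>
       (\<exists>\<gamma> \<delta>. cubic_mat a b c d *v v = \<gamma> *s u' + \<delta> *s v')"
    using det proj_pt_in_proj_line_left proj_pt_in_proj_line_right proj_pt_in_proj_lineD
    by metis
next
  assume "\<exists>a b c d. a * d - b * c \<noteq> 0 \<and>
       (\<exists>\<alpha> \<beta>. cubic_mat a b c d *v u = \<alpha> *s u' + \<beta> *s v') \<and>
       (\<exists>\<gamma> \<delta>. cubic_mat a b c d *v v = \<gamma> *s u' + \<delta> *s v')"
  then obtain a b c d \<alpha> \<beta> \<gamma> \<delta> where det: "a * d - b * c \<noteq> 0"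
    and "cubic_mat a b c d *v u = \<alpha> *s u' + \<beta> *s v'" "cubic_mat a b c d *v v = \<gamma> *s u' + \<delta> *s v'"
    by blast
  then have "proj_act (cubic_mat a b c d) (proj_line u v) = proj_line u' v'"
    using invertible_cubic_mat[OF det] indep by (intro proj_act_proj_line_eq)
  then show "same_orbit (proj_line u v) (proj_line u' v')"
    unfolding same_orbit_def using cubic_mat_in_Gq[OF det] by blast
qed

section \<open>The lines \<open>L\<^sub>c\<close> and \<open>\<ell>\<^sub>\<mu>\<close>\<close>

(* The images of P(1,0,0,1) and P(0,0,1,0) under cubic_mat a b c d satisfy x0 = x2 and x1 = mu x3,
   the equations of the line l_mu. *)
definition maps_Lc_into_ell :: "'a::field \<Rightarrow> 'a \<Rightarrow> 'a \<Rightarrow> 'a \<Rightarrow> 'a \<Rightarrow> bool" where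
  "maps_Lc_into_ell \<mu> a b c d \<longleftrightarrow>
     a^3 + b^3 = a*c^2 + b*d^2 \<and> a^2*c + b^2*d = \<mu> * (c^3 + d^3) \<and>
     3*a*b^2 = a*d^2 + 2*b*c*d \<and> b^2*c + 2*a*b*d = \<mu> * (3*c*d^2)"

lemma same_orbit_Lc_ell_iff:
  fixes \<mu> :: "'a::field"
  assumes "(2::'a) \<noteq> 0" "(3::'a) \<noteq> 0"
  shows "same_orbit (proj_line (vec4 1 0 0 1) (vec4 0 0 1 0)) (proj_line (vec4 0 \<mu> 0 1) (vec4 1 0 1 0))
     \<longleftrightarrow> (\<exists>a b c d. a * d - b * c \<noteq> 0 \<and> maps_Lc_into_ell \<mu> a b c d)"
proof -
  have indep: "x = 0 \<and> y = 0" if "x *s vec4 1 0 0 1 + y *s vec4 0 0 1 (0::'a) = 0" for x y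
    using that by (simp add: vec_eq_iff forall_4)
  have ell: "(\<exists>\<alpha> \<beta>. z = \<alpha> *s vec4 0 \<mu> 0 1 + \<beta> *s vec4 1 0 1 0) \<longleftrightarrow> z$1 = z$3 \<and> z$2 = \<mu> * z$4" for z
  proof
    assume "z$1 = z$3 \<and> z$2 = \<mu> * z$4"
    then have "z = z$4 *s vec4 0 \<mu> 0 1 + z$1 *s vec4 1 0 1 0"
      by (simp add: vec_eq_iff forall_4 mult.commute)
    then show "\<exists>\<alpha> \<beta>. z = \<alpha> *s vec4 0 \<mu> 0 1 + \<beta> *s vec4 1 0 1 0" by blast
  qed auto
  have "cubic_mat a b c d *v vec4 1 0 0 1 = vec4 (a^3 + b^3) (a^2*c + b^2*d) (a*c^2 + b*d^2) (c^3 + d^3)"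
    and "cubic_mat a b c d *v vec4 0 0 1 0 = vec4 (3*a*b^2) (b^2*c + 2*a*b*d) (a*d^2 + 2*b*c*d) (3*c*d^2)"
    for a b c d :: 'a
    unfolding vec4_eq_iff matrix_vector_mult_4 by (simp_all add: cubic_mat_def)
  moreover have "same_orbit (proj_line (vec4 1 0 0 1) (vec4 0 0 1 0)) (proj_line (vec4 0 \<mu> 0 1) (vec4 1 0 1 0))
     \<longleftrightarrow> (\<exists>a b c d. a * d - b * c \<noteq> 0 \<and>
       (\<exists>\<alpha> \<beta>. cubic_mat a b c d *v vec4 1 0 0 1 = \<alpha> *s vec4 0 \<mu> 0 1 + \<beta> *s vec4 1 0 1 0) \<and>
       (\<exists>\<gamma> \<delta>. cubic_mat a b c d *v vec4 0 0 1 0 = \<gamma> *s vec4 0 \<mu> 0 1 + \<delta> *s vec4 1 0 1 0))"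
    by (rule same_orbit_proj_line_iff[OF assms indep])
  ultimately show ?thesis
    unfolding ell maps_Lc_into_ell_def by simp
qed

lemma maps_Lc_into_ell_nonzero:
  fixes a b c d :: "'a::field"
  assumes "(2::'a) \<noteq> 0" "(3::'a) \<noteq> 0" "a * d - b * c \<noteq> 0" "maps_Lc_into_ell \<mu> a b c d"
  shows "a \<noteq> 0 \<and> b \<noteq> 0 \<and> c \<noteq> 0 \<and> d \<noteq> 0"
proof -
  have E1: "a^3 + b^3 = a*c^2 + b*d^2" and E3: "3*a*b^2 = a*d^2 + 2*b*c*d"
    and E4: "b^2*c + 2*a*b*d = \<mu> * (3*c*d^2)"
    using assms(4) unfolding maps_Lc_into_ell_def by simp_all
  have "a \<noteq> 0"
  proof
    assume "a = 0"
    then have "b \<noteq> 0" "c \<noteq> 0" "2*b*c*d = 0"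
      using assms(3) E3 by auto
    then have "d = 0" using assms(1) by simp
    then show False using E1 \<open>a = 0\<close> \<open>b \<noteq> 0\<close> by simp
  qed
  moreover have "c \<noteq> 0"
  proof
    assume "c = 0"
    then have "d \<noteq> 0" "2*a*b*d = 0"
      using assms(3) E4 by auto
    then have "b = 0" using assms(1) \<open>a \<noteq> 0\<close> by simp
    then show False using E1 \<open>c = 0\<close> \<open>a \<noteq> 0\<close> by simp
  qed
  moreover have "b \<noteq> 0"
    using E3 assms(3) \<open>a \<noteq> 0\<close> by auto
  moreover have "d \<noteq> 0"
    using E3 assms(2) \<open>a \<noteq> 0\<close> \<open>b \<noteq> 0\<close> by auto
  ultimately show ?thesis by blast
qed

lemma maps_Lc_into_ell_product:
  fixes a b c d :: "'a::field"
  assumes "(2::'a) \<noteq> 0" "(3::'a) \<noteq> 0" "a * d - b * c \<noteq> 0" "maps_Lc_into_ell \<mu> a b c d"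
  shows "(b*c + 2*a*d) * (a*d + 2*b*c) = 9*\<mu>*a*b*c*d"
proof -
  have E3: "3*a*b^2 = a*d^2 + 2*b*c*d" and E4: "b^2*c + 2*a*b*d = \<mu> * (3*c*d^2)"
    using assms(4) unfolding maps_Lc_into_ell_def by simp_all
  have "(b*d) * ((b*c + 2*a*d) * (a*d + 2*b*c)) = (b^2*c + 2*a*b*d) * (a*d^2 + 2*b*c*d)"
    by algebra
  also have "\<dots> = (\<mu> * (3*c*d^2)) * (3*a*b^2)"
    by (simp only: E4 E3[symmetric])
  also have "\<dots> = (b*d) * (9*\<mu>*a*b*c*d)"
    by algebra
  finally show ?thesis
    using maps_Lc_into_ell_nonzero[OF assms] by simp
qed

lemma maps_Lc_into_ell_quadric:
  fixes a b c d :: "'a::field"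
  assumes "(2::'a) \<noteq> 0" "(3::'a) \<noteq> 0" and det: "a * d - b * c \<noteq> 0"
    and maps: "maps_Lc_into_ell \<mu> a b c d"
  shows "(a*d)^2 + 4*(a*d)*(b*c) + (b*c)^2 = 0"
proof -
  have E1: "a^3 + b^3 = a*c^2 + b*d^2" and E2: "a^2*c + b^2*d = \<mu> * (c^3 + d^3)"
    and E3: "3*a*b^2 = a*d^2 + 2*b*c*d"
    using maps unfolding maps_Lc_into_ell_def by simp_all
  have "(a*d - b*c) * (a^2 * (a*d + 3*b*c) - 2*b^3*d)
      = (a*d^2 + 2*b*c*d) * (a^3 + b^3) - 3*a*b^2 * (a*c^2 + b*d^2)"
    by algebra
  also have "\<dots> = 0"
    using E1 E3 by simp
  finally have F1: "a^2 * (a*d + 3*b*c) = 2*b^3*d"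
    using det by simp
  have dP: "d * (a*d + 2*b*c) = 3*a*b^2"
    using E3 by (simp add: algebra_simps power2_eq_square)
  then have "a*d + 2*b*c \<noteq> 0"
    using maps_Lc_into_ell_nonzero[OF assms] assms(2) by auto
  have "(a*d - b*c) * (a*d + 2*b*c) * (c^2 * (3*a*d + b*c) - 2*b*d^3)
      = 3*c*d * (d*(a*d + 2*b*c)*(a^2*c + b^2*d) - 3*\<mu>*a*b^2*(c^3 + d^3))
        + b*(c^3 + d^3) * (9*\<mu>*a*b*c*d - (b*c + 2*a*d)*(a*d + 2*b*c))"
    by algebra
  also have "\<dots> = 0"
    using dP E2 maps_Lc_into_ell_product[OF assms] by (simp add: algebra_simps)
  finally have F2: "c^2 * (3*a*d + b*c) = 2*b*d^3"
    using det \<open>a*d + 2*b*c \<noteq> 0\<close> by simp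
  have "(a*d - b*c) * ((a*d)^2 + 4*(a*d)*(b*c) + (b*c)^2)
      = d^2 * (a^2 * (a*d + 3*b*c)) - b^2 * (c^2 * (3*a*d + b*c))"
    by algebra
  also have "\<dots> = 0"
    unfolding F1 F2 by algebra
  finally show ?thesis
    using det by simp
qed

lemma maps_Lc_into_ell_imp:
  fixes a b c d :: "'a::field"
  assumes "(2::'a) \<noteq> 0" "(3::'a) \<noteq> 0" "a * d - b * c \<noteq> 0" "maps_Lc_into_ell \<mu> a b c d"
  shows "\<mu> = -1/3 \<and> (\<exists>s::'a. s^2 = 3)"
proof -
  have "a \<noteq> 0" "b \<noteq> 0" "c \<noteq> 0" "d \<noteq> 0"
    using maps_Lc_into_ell_nonzero[OF assms] by simp_all
  note Q = maps_Lc_into_ell_quadric[OF assms]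
  have "3 * (a*d) * (b*c) * (3*\<mu> + 1)
      = 9*\<mu>*a*b*c*d - (b*c + 2*a*d) * (a*d + 2*b*c) + 2 * ((a*d)^2 + 4*(a*d)*(b*c) + (b*c)^2)"
    by algebra
  also have "\<dots> = 0"
    using maps_Lc_into_ell_product[OF assms] Q by simp
  finally have "3*\<mu> + 1 = 0"
    using assms(2) \<open>a \<noteq> 0\<close> \<open>b \<noteq> 0\<close> \<open>c \<noteq> 0\<close> \<open>d \<noteq> 0\<close> by simp
  then have "\<mu> = -1/3"
    using assms(2) by (simp add: field_simps eq_neg_iff_add_eq_0)
  moreover have "(a*d + 2*b*c)^2 = 3 * (b*c)^2"
    using Q by algebra
  then have "((a*d + 2*b*c) / (b*c))^2 = 3"
    using \<open>b \<noteq> 0\<close> \<open>c \<noteq> 0\<close> by (simp add: power_divide)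
  then have "\<exists>s::'a. s^2 = 3" ..
  ultimately show ?thesis by blast
qed

(* The elimination in maps_Lc_into_ell_quadric forces b c = r a d with r^2 + 4 r + 1 = 0; this
   witness has b = r k a and d = k c, and the remaining equations fix e^2 = 3, a^2 = 1 + 2 r and
   k^3 = (1 + 3 r) / (2 r^3). *)
lemma maps_Lc_into_ell_witness:
  fixes e r w k :: "'a::field"
  assumes "(2::'a) \<noteq> 0" "(3::'a) \<noteq> 0"
    and e: "e^2 = 3" and r: "r^2 + 4*r + 1 = 0" and w: "w^2 = 1 + 2*r"
    and k: "2*r^3*k^3 = 1 + 3*r"
  shows "maps_Lc_into_ell (-1/3) w (r*k*w) (e*r) (k*e*r)"
proof -
  have "2 * (w^3 + (r*k*w)^3 - (w*(e*r)^2 + (r*k*w)*(k*e*r)^2)) =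
      2*w*(1 + r^3*k^3)*(w^2 - (1 + 2*r)) - 2*w*r^2*(1 + r*k^3)*(e^2 - 3)
      + 2*w*(1 - r)*((1 + 3*r) - 2*r^3*k^3)"
    by algebra
  also have "\<dots> = 0"
    using e w k by simp
  finally have E1: "w^3 + (r*k*w)^3 = w*(e*r)^2 + (r*k*w)*(k*e*r)^2"
    using assms(1) by (metis mult_eq_0_iff right_minus_eq)
  have "3 * (w^2*(e*r) + (r*k*w)^2*(k*e*r)) + ((e*r)^3 + (k*e*r)^3) =
      3*e*r*(w^2 - (1 + 2*r))*(1 + r^2*k^3) + e*r^3*(1 + k^3)*(e^2 - 3)
      + 3*e*(1 + r)*((r^2 + 4*r + 1) + (2*r^3*k^3 - (1 + 3*r)))"
    by algebra
  also have "\<dots> = 0"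
    using e r w k by simp
  finally have E2: "w^2*(e*r) + (r*k*w)^2*(k*e*r) = -1/3 * ((e*r)^3 + (k*e*r)^3)"
    using e r w k assms(2) by (simp add: field_simps eq_neg_iff_add_eq_0)
  have "3*w*(r*k*w)^2 - (w*(k*e*r)^2 + 2*(r*k*w)*(e*r)*(k*e*r))
      = w*k^2*r^2*(3*(w^2 - (1 + 2*r)) - (1 + 2*r)*(e^2 - 3))"
    by algebra
  then have E3: "3*w*(r*k*w)^2 = w*(k*e*r)^2 + 2*(r*k*w)*(e*r)*(k*e*r)"
    using e w by simp
  have "(r*k*w)^2*(e*r) + 2*w*(r*k*w)*(k*e*r) + (e*r)*(k*e*r)^2
      = e*r*k^2*((r^2 + 2*r)*(w^2 - (1 + 2*r)) + r^2*(e^2 - 3) + 2*r*(r^2 + 4*r + 1))"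
    by algebra
  also have "\<dots> = 0"
    using e r w by simp
  finally have "(r*k*w)^2*(e*r) + 2*w*(r*k*w)*(k*e*r) = - ((e*r)*(k*e*r)^2)"
    by (simp add: eq_neg_iff_add_eq_0)
  then have E4: "(r*k*w)^2*(e*r) + 2*w*(r*k*w)*(k*e*r) = -1/3 * (3*(e*r)*(k*e*r)^2)"
    using assms(2) by simp
  show ?thesis
    unfolding maps_Lc_into_ell_def using E1 E2 E3 E4 by blast
qed

lemma exists_quadratic_root_with_square:
  assumes "odd CARD('a::{finite,field})" "\<nexists>y::'a. y^2 = -3" "(e::'a)^2 = 3"
  shows "\<exists>r w::'a. r^2 + 4*r + 1 = 0 \<and> w^2 = 1 + 2*r"
proof (rule ccontr)
  assume no: "\<not> ?thesis"
  have "(-2 + e)^2 + 4*(-2 + e) + 1 = 0" "(-2 - e)^2 + 4*(-2 - e) + 1 = 0"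
    using assms(3) by (simp_all add: power2_eq_square algebra_simps)
  then have "\<nexists>w. w^2 = 1 + 2*(-2 + e)" "\<nexists>w. w^2 = 1 + 2*(-2 - e)"
    using no by blast+
  then obtain y where "y^2 = (1 + 2*(-2 + e)) * (1 + 2*(-2 - e))"
    using nonsquare_mult_nonsquare[OF assms(1)] by blast
  moreover have "(1 + 2*(-2 + e)) * (1 + 2*(-2 - e)) = 9 - 4*e^2"
    by algebra
  then have "(1 + 2*(-2 + e)) * (1 + 2*(-2 - e)) = -3"
    using assms(3) by simp
  ultimately show False
    using assms(2) by auto
qed

lemma exists_maps_Lc_into_ell:
  assumes "odd CARD('a::{finite,field})" "CARD('a) mod 3 = 2"
    and "\<nexists>y::'a. y^2 = -3" "\<exists>e::'a. e^2 = 3"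
  shows "\<exists>a b c d::'a. a * d - b * c \<noteq> 0 \<and> maps_Lc_into_ell (-1/3) a b c d"
proof -
  have two: "(2::'a) \<noteq> 0" and three: "(3::'a) \<noteq> 0"
    using assms(1,2) by (simp_all add: two_neq_0_finite_field three_neq_0_finite_field)
  obtain e :: 'a where e: "e^2 = 3"
    using assms(4) by blast
  obtain r w :: 'a where r: "r^2 + 4*r + 1 = 0" and w: "w^2 = 1 + 2*r"
    using exists_quadratic_root_with_square[OF assms(1,3) e] by blast
  have "w \<noteq> 0"
  proof
    assume "w = 0"
    then have "4 * (r^2 + 4*r + 1) = -3"
      using w by algebra
    then show False using r three by simp
  qed
  have "1 + 3*r \<noteq> 0"
  proof
    assume "1 + 3*r = 0"
    then have "9 * (r^2 + 4*r + 1) = -2"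
      by algebra
    then show False using r two by simp
  qed
  have "r \<noteq> 0" "r \<noteq> 1" "e \<noteq> 0"
    using r e two three mult_eq_0_iff[of "2::'a" 3] by auto
  obtain k :: 'a where "k^3 = (1 + 3*r) / (2*r^3)"
    using exists_cube_root[OF assms(2)] by blast
  then have k: "2*r^3*k^3 = 1 + 3*r"
    using \<open>r \<noteq> 0\<close> two by simp
  then have "k \<noteq> 0"
    using \<open>1 + 3*r \<noteq> 0\<close> by auto
  have "w * (k*e*r) - (r*k*w) * (e*r) = w*k*e*r * (1 - r)"
    by algebra
  then have "w * (k*e*r) - (r*k*w) * (e*r) \<noteq> 0"
    using \<open>w \<noteq> 0\<close> \<open>k \<noteq> 0\<close> \<open>e \<noteq> 0\<close> \<open>r \<noteq> 0\<close> \<open>r \<noteq> 1\<close> by simp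
  then show ?thesis
    using maps_Lc_into_ell_witness[OF two three e r w k] by blast
qed

lemma three_square_iff:
  assumes "odd CARD('a::{finite,field})" "\<nexists>y::'a. y^2 = -3"
  shows "(\<exists>s::'a. s^2 = 3) \<longleftrightarrow> CARD('a) mod 4 = 3"
proof -
  have "(\<exists>s::'a. s^2 = 3) \<longleftrightarrow> (\<nexists>y::'a. y^2 = -1)"
  proof
    assume "\<exists>s::'a. s^2 = 3"
    then obtain s :: 'a where "s^2 = 3" by blast
    then have "(s * y)^2 = -3" if "y^2 = -1" for y
      using that by (simp add: power_mult_distrib)
    then show "\<nexists>y::'a. y^2 = -1"
      using assms(2) by blast
  next
    assume "\<nexists>y::'a. y^2 = -1"
    then show "\<exists>s::'a. s^2 = 3"
      using nonsquare_mult_nonsquare[OF assms] by fastforce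
  qed
  also have "\<dots> \<longleftrightarrow> CARD('a) mod 4 = 3"
    using minus_one_square_iff[OF assms(1)] assms(1) by presburger
  finally show ?thesis .
qed

lemma nonsquare_minus_3:
  assumes "(3::'a::field) \<noteq> 0" "\<nexists>x::'a. x^2 = -1/3"
  shows "\<nexists>y::'a. y^2 = -3"
proof
  assume "\<exists>y::'a. y^2 = -3"
  then obtain y :: 'a where "y^2 = -3" by blast
  then have "(y / 3)^2 = -1/3"
    using assms(1) by (simp add: power_divide power2_eq_square)
  then show False using assms(2) by blast
qed

theorem lemma7p4:
  fixes \<mu> :: "'a::{finite, field}"
  assumes "odd CARD('a)"
    and "CARD('a) mod 3 = 2"
    and "\<not> (\<exists>x::'a. x ^ 2 = \<mu>)"
  shows "same_orbit (proj_line (vec4 1 0 0 1) (vec4 0 0 1 (0::'a)))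
                    (proj_line (vec4 0 \<mu> 0 1) (vec4 1 0 1 0))
         \<longleftrightarrow> (\<mu> = - 1 / 3 \<and> CARD('a) mod 12 = 11)"
proof -
  have two: "(2::'a) \<noteq> 0" and three: "(3::'a) \<noteq> 0"
    using assms(1,2) by (simp_all add: two_neq_0_finite_field three_neq_0_finite_field)
  have minus_3_nonsquare: "\<nexists>y::'a. y^2 = -3" if "\<mu> = -1/3"
    using nonsquare_minus_3[OF three] assms(3) that by blast
  have "same_orbit (proj_line (vec4 1 0 0 1) (vec4 0 0 1 0)) (proj_line (vec4 0 \<mu> 0 1) (vec4 1 0 1 0))
      \<longleftrightarrow> (\<exists>a b c d. a * d - b * c \<noteq> 0 \<and> maps_Lc_into_ell \<mu> a b c d)"
    by (rule same_orbit_Lc_ell_iff[OF two three])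
  also have "\<dots> \<longleftrightarrow> \<mu> = -1/3 \<and> (\<exists>s::'a. s^2 = 3)"
    using maps_Lc_into_ell_imp[OF two three] exists_maps_Lc_into_ell[OF assms(1,2) minus_3_nonsquare]
    by blast
  also have "\<dots> \<longleftrightarrow> \<mu> = -1/3 \<and> CARD('a) mod 12 = 11"
  proof -
    have "CARD('a) mod 4 = 3 \<longleftrightarrow> CARD('a) mod 12 = 11"
      using assms(2) by presburger
    then show ?thesis
      using three_square_iff[OF assms(1) minus_3_nonsquare] by blast
  qed
  finally show ?thesis .
qed

end
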